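(* There exists a constant $c>0$ such that for all integers $n\ge 2$ and $k\ge 1$, $$D(n,k) \ge \max\left( \frac{n^2}{2} - c\,n^{3/2},\ \ k\bigl((n-1)\log(n-1) - 2(n-2)\bigr)\right).$$
   Context: For integers $k,n\ge 1$, the generalised symmetric group $C_k \wr S_n$ is regarded as the subgroup of $GL_n(\mathbb{C})$ consisting of the matrices with exactly one non-zero entry in each row and each column, all of whose non-zero entries are $k$-th roots of unity. Let $V=\mathbb{C}^n$ be its natural representation, and for each integer $r\ge 0$ let $\chi_r$ be the character of $C_k\wr S_n$ on the symmetric power $\mathrm{Sym}^r V$. Define $D(n,k) = \dim_{\mathbb{C}} \mathrm{Span}_{\mathbb{C}}\{\chi_r : r \ge 0\}$, the dimension of the span inside the space of complex class functions on $C_k\wr S_n$. Here $\log$ is the natural logarithm. *)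

theory Defs
  imports
    Complex_Main
    "HOL-Library.Poly_Mapping"
    "HOL-Library.Function_Algebras"
    "Jordan_Normal_Form.Matrix"
begin

definition gen_sym_group :: "nat \<Rightarrow> nat \<Rightarrow> complex mat set" where
  "gen_sym_group n k = {g \<in> carrier_mat n n.
     (\<forall>i<n. \<exists>!j. j < n \<and> g $$ (i, j) \<noteq> 0) \<and>
     (\<forall>j<n. \<exists>!i. i < n \<and> g $$ (i, j) \<noteq> 0) \<and>
     (\<forall>i<n. \<forall>j<n. g $$ (i, j) \<noteq> 0 \<longrightarrow> g $$ (i, j) ^ k = 1)}"

text \<open>
  The symmetric algebra of \<open>V = \<complex>\<^sup>n\<close> is realised as the polynomial ring in the variables
  \<open>X 0, \<dots>, X (n - 1)\<close>, where \<open>X i\<close> is the standard basis vector \<open>e\<^sub>i\<close> of \<open>V\<close> (not a coordinate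
  function on \<open>V\<close>), and the symmetric power of degree \<open>r\<close> is its homogeneous part of degree \<open>r\<close>.
  A polynomial maps exponent vectors to coefficients.
\<close>

type_synonym cpoly = "(nat \<Rightarrow>\<^sub>0 nat) \<Rightarrow>\<^sub>0 complex"

definition poly_scale :: "complex \<Rightarrow> cpoly \<Rightarrow> cpoly" where
  "poly_scale c p = Poly_Mapping.single 0 c * p"

definition poly_var :: "nat \<Rightarrow> cpoly" where
  "poly_var i = Poly_Mapping.single (Poly_Mapping.single i 1) 1"

definition poly_monom :: "(nat \<Rightarrow>\<^sub>0 nat) \<Rightarrow> cpoly" where
  "poly_monom m = Poly_Mapping.single m 1"

definition exponents :: "nat \<Rightarrow> nat \<Rightarrow> (nat \<Rightarrow>\<^sub>0 nat) set" where
  "exponents n r =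
     {m. Poly_Mapping.keys m \<subseteq> {..<n} \<and> (\<Sum>i<n. Poly_Mapping.lookup m i) = r}"

definition sym_power :: "nat \<Rightarrow> nat \<Rightarrow> cpoly set" where
  "sym_power n r = {p. Poly_Mapping.keys p \<subseteq> exponents n r}"

definition vec_to_poly :: "complex vec \<Rightarrow> cpoly" where
  "vec_to_poly v = (\<Sum>i<dim_vec v. poly_scale (v $ i) (poly_var i))"

text \<open>
  The action of \<open>g\<close> on the symmetric algebra: the linear map sending a product of basis vectors
  \<open>e\<^sub>j\<close> to the product of their images \<open>g e\<^sub>j\<close>.
\<close>

definition sym_action :: "nat \<Rightarrow> complex mat \<Rightarrow> cpoly \<Rightarrow> cpoly" where
  "sym_action n g p =
     (\<Sum>m\<in>Poly_Mapping.keys p. poly_scale (Poly_Mapping.lookup p m)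
        (\<Prod>j<n. vec_to_poly (g *\<^sub>v unit_vec n j) ^ Poly_Mapping.lookup m j))"

text \<open>
  The character is the trace of \<open>sym_action n g\<close> on \<open>sym_power n r\<close>, taken in the basis of
  monomials (see \<open>monomials_basis\<close> below).  Functions on the group are extended by \<open>0\<close> to the whole
  matrix type, so that linear relations are tested on the group only.
\<close>

definition sym_character :: "nat \<Rightarrow> nat \<Rightarrow> nat \<Rightarrow> complex mat \<Rightarrow> complex" where
  "sym_character n k r g =
     (if g \<in> gen_sym_group n k
      then \<Sum>m\<in>exponents n r. Poly_Mapping.lookup (sym_action n g (poly_monom m)) m
      else 0)"

definition fun_scale :: "complex \<Rightarrow> (complex mat \<Rightarrow> complex) \<Rightarrow> complex mat \<Rightarrow> complex" where
  "fun_scale c f = (\<lambda>g. c * f g)"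

global_interpretation fun_space: vector_space fun_scale
  by unfold_locales (auto simp: fun_scale_def fun_eq_iff algebra_simps)

definition dim_span_sym_characters :: "nat \<Rightarrow> nat \<Rightarrow> nat" where
  "dim_span_sym_characters n k =
     fun_space.dim (fun_space.span (range (sym_character n k)))"


subsection \<open>The monomials form a basis of the symmetric power\<close>

lemma lookup_poly_scale [simp]:
  "Poly_Mapping.lookup (poly_scale c p) m = c * Poly_Mapping.lookup p m"
  by (simp add: poly_scale_def mult_map_scale_conv_mult[symmetric] Poly_Mapping.map.rep_eq when_def)

global_interpretation cpoly: vector_space poly_scale
  by unfold_locales (auto intro!: poly_mapping_eqI simp: lookup_add algebra_simps)

lemma finite_exponents: "finite (exponents n r)"
proof -
  let ?F = "{f. \<forall>i. (i \<in> {..<n} \<longrightarrow> f i \<in> {..r}) \<and> (i \<notin> {..<n} \<longrightarrow> f i = (0::nat))}"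
  have "finite ?F"
    by (rule finite_set_of_finite_funs) auto
  moreover have "Poly_Mapping.lookup ` exponents n r \<subseteq> ?F"
  proof (clarsimp simp: exponents_def, intro conjI impI)
    fix m :: "nat \<Rightarrow>\<^sub>0 nat" and i
    assume "Poly_Mapping.keys m \<subseteq> {..<n}"
    show "Poly_Mapping.lookup m i \<le> (\<Sum>i<n. Poly_Mapping.lookup m i)" if "i < n"
      using that by (intro member_le_sum) auto
    show "Poly_Mapping.lookup m i = 0" if "\<not> i < n"
      using that \<open>Poly_Mapping.keys m \<subseteq> {..<n}\<close> by (auto simp: in_keys_iff)
  qed
  ultimately show ?thesis
    by (meson finite_imageD finite_subset inj_onI poly_mapping.lookup_inject[THEN iffD1])
qed

lemma poly_eq_sum_monoms:
  "p = (\<Sum>m\<in>Poly_Mapping.keys p. poly_scale (Poly_Mapping.lookup p m) (poly_monom m))"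
  by (intro poly_mapping_eqI)
    (simp add: lookup_sum poly_monom_def lookup_single when_def in_keys_iff if_distrib cong: if_cong)

lemma subspace_sym_power: "cpoly.subspace (sym_power n r)"
  by (auto simp: cpoly.subspace_def sym_power_def subset_iff in_keys_iff lookup_add)
    (metis add_0)+

lemma monomials_basis:
  "inj poly_monom"
  "\<not> cpoly.dependent (poly_monom ` exponents n r)"
  "cpoly.span (poly_monom ` exponents n r) = sym_power n r"
proof -
  show inj: "inj poly_monom"
    by (rule injI) (metis lookup_single_eq lookup_single_not_eq poly_monom_def zero_neq_one)
  show "\<not> cpoly.dependent (poly_monom ` exponents n r)"
  proof (rule cpoly.independent_if_scalars_zero)
    show "finite (poly_monom ` exponents n r)" by (simp add: finite_exponents)
  next
    fix f x
    assume 0: "(\<Sum>x\<in>poly_monom ` exponents n r. poly_scale (f x) x) = 0"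
      and "x \<in> poly_monom ` exponents n r"
    then obtain m where m: "m \<in> exponents n r" "x = poly_monom m" by auto
    have "0 = Poly_Mapping.lookup (\<Sum>m\<in>exponents n r. poly_scale (f (poly_monom m)) (poly_monom m)) m"
      using 0 by (subst (asm) sum.reindex) (auto intro: inj_on_subset[OF inj] simp: o_def)
    also have "\<dots> = f x"
      using m finite_exponents[of n r]
      by (simp add: lookup_sum poly_monom_def lookup_single when_def if_distrib cong: if_cong)
    finally show "f x = 0" by simp
  qed
  show "cpoly.span (poly_monom ` exponents n r) = sym_power n r"
  proof
    show "cpoly.span (poly_monom ` exponents n r) \<subseteq> sym_power n r"
      by (intro cpoly.span_minimal subspace_sym_power) (auto simp: sym_power_def poly_monom_def)
    show "sym_power n r \<subseteq> cpoly.span (poly_monom ` exponents n r)"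
    proof
      fix p assume "p \<in> sym_power n r"
      then have "(\<Sum>m\<in>Poly_Mapping.keys p. poly_scale (Poly_Mapping.lookup p m) (poly_monom m))
          \<in> cpoly.span (poly_monom ` exponents n r)"
        unfolding sym_power_def by (blast intro: cpoly.span_sum cpoly.span_scale cpoly.span_base)
      then show "p \<in> cpoly.span (poly_monom ` exponents n r)"
        by (metis poly_eq_sum_monoms)
    qed
  qed
qed


subsection \<open>The action is linear and preserves the symmetric power\<close>

lemma one_sym_power: "1 \<in> sym_power n 0"
  by (auto simp: sym_power_def exponents_def in_keys_iff lookup_one when_def)

lemma mult_sym_power:
  assumes "p \<in> sym_power n a" "q \<in> sym_power n b"
  shows "p * q \<in> sym_power n (a + b)"
proof -
  have "u + v \<in> exponents n (a + b)" if "u \<in> exponents n a" "v \<in> exponents n b" for u v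
    using that Poly_Mapping.keys_add[of u v]
    by (auto simp: exponents_def lookup_add sum.distrib)
  then show ?thesis
    using assms keys_mult[of p q] unfolding sym_power_def by blast
qed

lemma power_sym_power: "p \<in> sym_power n a \<Longrightarrow> p ^ e \<in> sym_power n (e * a)"
  by (induction e) (auto simp: one_sym_power mult_sym_power)

lemma prod_sym_power:
  assumes "finite A" "\<And>j. j \<in> A \<Longrightarrow> f j \<in> sym_power n (d j)"
  shows "(\<Prod>j\<in>A. f j) \<in> sym_power n (\<Sum>j\<in>A. d j)"
  using assms by (induction rule: finite_induct) (auto simp: one_sym_power mult_sym_power)

lemma vec_to_poly_sym_power:
  assumes "dim_vec v = n"
  shows "vec_to_poly v \<in> sym_power n 1"
proof -
  have "poly_var i \<in> sym_power n 1" if "i < n" for i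
    using that by (simp add: sym_power_def exponents_def poly_var_def lookup_single when_def)
  then show ?thesis
    unfolding vec_to_poly_def using assms
    by (auto intro!: cpoly.subspace_sum cpoly.subspace_scale subspace_sym_power)
qed

lemma sym_action_sym_power:
  assumes "g \<in> carrier_mat n n" "p \<in> sym_power n r"
  shows "sym_action n g p \<in> sym_power n r"
  unfolding sym_action_def
proof (intro cpoly.subspace_sum cpoly.subspace_scale subspace_sym_power)
  fix m assume "m \<in> Poly_Mapping.keys p"
  with assms(2) have r: "(\<Sum>j<n. Poly_Mapping.lookup m j * 1) = r"
    by (auto simp: sym_power_def exponents_def)
  show "(\<Prod>j<n. vec_to_poly (g *\<^sub>v unit_vec n j) ^ Poly_Mapping.lookup m j) \<in> sym_power n r"
    unfolding r[symmetric]
    by (intro prod_sym_power power_sym_power vec_to_poly_sym_power) (use assms(1) in auto)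
qed

lemma sym_action_superset:
  assumes "finite A" "Poly_Mapping.keys p \<subseteq> A"
  shows "sym_action n g p = (\<Sum>m\<in>A. poly_scale (Poly_Mapping.lookup p m)
           (\<Prod>j<n. vec_to_poly (g *\<^sub>v unit_vec n j) ^ Poly_Mapping.lookup m j))"
  unfolding sym_action_def
  by (rule sum.mono_neutral_left) (use assms in \<open>auto simp: in_keys_iff\<close>)

lemma sym_action_add: "sym_action n g (p + q) = sym_action n g p + sym_action n g q"
proof -
  let ?A = "Poly_Mapping.keys p \<union> Poly_Mapping.keys q"
  have "Poly_Mapping.keys (p + q) \<subseteq> ?A"
    by (rule Poly_Mapping.keys_add)
  then show ?thesis
    by (simp add: sym_action_superset[of ?A] lookup_add cpoly.scale_left_distrib sum.distrib)
qed

lemma sym_action_scale: "sym_action n g (poly_scale c p) = poly_scale c (sym_action n g p)"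
proof -
  have "Poly_Mapping.keys (poly_scale c p) \<subseteq> Poly_Mapping.keys p"
    by (auto simp: in_keys_iff)
  then show ?thesis
    by (simp add: sym_action_superset[of "Poly_Mapping.keys p"] cpoly.scale_sum_right)
qed

end

theory Submission
  imports Defs "HOL-Computational_Algebra.Formal_Power_Series"
begin

unbundle fps_syntax
no_notation vec_index (infixl "$" 100)

text \<open>
  By Molien, \<open>\<Sum>\<^sub>r \<chi>\<^sub>r(g) X\<^sup>r = 1 / det (1 - g X)\<close>, which for a monomial matrix is a product of factors
  \<open>1 / (1 - \<zeta> X\<^sup>l)\<close>, one for each cycle.  A linear relation among the \<open>\<chi>\<^sub>r\<close> is a functional on power
  series vanishing on all these products, so the dimension is at least the number of valuations
  that occur in their span.  Averaging over \<open>\<zeta>\<close> puts \<open>X\<^sup>r\<^sup>l / (1 - X\<^sup>k\<^sup>l)\<close> for \<open>r < k\<close> in place of a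
  cycle, and Newton's identity turns the power sums \<open>p\<^sub>l = 1 / (1 - q\<^sup>l)\<close> at \<open>q = X\<^sup>k\<close> into the
  elementary symmetric functions \<open>e\<^sub>l(1, q, q\<^sup>2, \<dots>)\<close>, of valuation \<open>k (l choose 2)\<close>.  Hence every
  \<open>k \<Sum>\<^sub>i (\<lambda>\<^sub>i choose 2) + r\<close> with \<open>\<Sum>\<^sub>i \<lambda>\<^sub>i \<le> n - 1\<close> and \<open>r < k\<close> is a valuation, and it remains to write
  all small numbers as such sums of binomial coefficients by a greedy choice of the \<open>\<lambda>\<^sub>i\<close>.
\<close>

subsection \<open>Sums of triangular numbers\<close>

text \<open>The budget \<open>m\<close> will count the matrix rows spent on cycles, and
  \<open>k * q\<close> the valuation bought with them. An inequality suffices, as spare rows become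
  parts of size 1, with \<open>1 choose 2 = 0\<close>.\<close>

definition binom_sum :: "nat \<Rightarrow> nat \<Rightarrow> bool" where
  "binom_sum m q \<longleftrightarrow> (\<exists>xs. sum_list xs \<le> m \<and> (\<Sum>x\<leftarrow>xs. x choose 2) = q)"

lemma binom_sum_mono: "binom_sum m q \<Longrightarrow> m \<le> m' \<Longrightarrow> binom_sum m' q"
  unfolding binom_sum_def using le_trans by blast

lemma binom_sum_add: "binom_sum m q \<Longrightarrow> binom_sum (b + m) ((b choose 2) + q)"
  unfolding binom_sum_def by (metis add_left_mono list.map(2) sum_list.Cons)

text \<open>Parts of size 3 contribute exactly their size. The remainder of \<open>q\<close> modulo
  3 is filled by parts of size 2, each contributing 1, so at most two units are lost.\<close>

lemma binom_sum_linear: "binom_sum (q + 2) q"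
proof -
  let ?xs = "replicate (q div 3) 3 @ replicate (q mod 3) (2::nat)"
  have "(3::nat) choose 2 = 3" by (simp add: numeral_2_eq_2 numeral_3_eq_3)
  then have "(\<Sum>x\<leftarrow>?xs. x choose 2) = q"
    by (simp add: sum_list_replicate)
  moreover have "sum_list ?xs \<le> q + 2"
    by (simp add: sum_list_replicate) presburger
  ultimately show ?thesis unfolding binom_sum_def by blast
qed

lemma choose_2_Suc: "Suc b choose 2 = (b choose 2) + b"
  by (simp add: numeral_2_eq_2)

text \<open>Here \<open>b\<close> is the largest number with \<open>b choose 2 \<le> q\<close>; the
  gap to the next triangular number is \<open>b\<close>, hence \<open>w < b\<close>.\<close>

lemma greedy_binom:
  obtains b w where "q = (b choose 2) + w" "w < b"
proof -
  have "\<exists>b w. q = (b choose 2) + w \<and> w < b"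
  proof (induction q)
    case 0
    show ?case by (intro exI[of _ 1] exI[of _ 0]) (simp add: numeral_2_eq_2)
  next
    case (Suc q)
    then obtain b w where bw: "q = (b choose 2) + w" "w < b" by blast
    show ?case
    proof (cases "Suc w < b")
      case True
      then show ?thesis using bw by (metis add_Suc_right)
    next
      case False
      then have "Suc q = (Suc b choose 2) + 0" using bw by (simp add: choose_2_Suc)
      then show ?thesis by blast
    qed
  qed
  then show ?thesis using that by blast
qed

text \<open>One greedy step costs \<open>b \<le> a\<close>, and the remainder \<open>w < b\<close>
  costs at most \<open>w + 2 \<le> a + 1\<close> by the linear representation.\<close>

lemma binom_sum_below_triangular:
  assumes "q < Suc a choose 2" "2 * a + 1 \<le> m"
  shows "binom_sum m q"
proof -
  obtain b w where bw: "q = (b choose 2) + w" "w < b" by (rule greedy_binom)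
  have "b \<le> a"
  proof (rule ccontr)
    assume "\<not> b \<le> a"
    then have "Suc a choose 2 \<le> b choose 2" by (intro binomial_right_mono) auto
    then show False using bw assms by simp
  qed
  then show ?thesis
    using binom_sum_mono[OF binom_sum_add[OF binom_sum_linear[of w], of b], of m] bw assms by simp
qed

lemma greedy_binom_bounds:
  assumes "q = (b choose 2) + w" "w < b"
  shows "real b \<le> 1 + sqrt (2 * real q)" "real w \<le> sqrt (2 * real q)"
proof -
  have "(real b - 1)\<^sup>2 \<le> 2 * real (b choose 2)"
    using assms(2) by (cases b) (simp_all add: choose_two power2_eq_square field_simps real_of_nat_div)
  then have "real b - 1 \<le> sqrt (2 * real q)"
    using assms by (intro real_le_rsqrt) auto
  then show "real b \<le> 1 + sqrt (2 * real q)" "real w \<le> sqrt (2 * real q)"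
    using assms(2) by auto
qed

text \<open>Two greedy steps, then the linear representation of \<open>w'\<close>. The costs are at
  most \<open>1 + sqrt (2 * q)\<close>, \<open>1 + sqrt (2 * w)\<close> and
  \<open>2 + sqrt (2 * w)\<close>. Since \<open>w \<le> m\<close>, the two roots of
  \<open>2 * w\<close> together stay below \<open>3 * sqrt m\<close>.\<close>

lemma binom_sum_greedy:
  assumes "sqrt (2 * real q) \<le> real m - 4 - 3 * sqrt (real m)"
  shows "binom_sum m q"
proof -
  define x where "x = sqrt (2 * real q)"
  obtain b w where bw: "q = (b choose 2) + w" "w < b" by (rule greedy_binom)
  obtain b' w' where bw': "w = (b' choose 2) + w'" "w' < b'" by (rule greedy_binom)
  have "x \<le> real m"
    using assms x_def real_sqrt_ge_zero[of "real m"] by linarith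
  have "sqrt (2 * real w) \<le> sqrt (2 * real m)"
    using greedy_binom_bounds(2)[OF bw] \<open>x \<le> real m\<close> by (simp add: x_def)
  also have "\<dots> \<le> 3 / 2 * sqrt (real m)"
  proof -
    have "sqrt 2 \<le> 3 / 2" by (rule real_le_lsqrt) (auto simp: power2_eq_square)
    then show ?thesis using mult_right_mono[of "sqrt 2" "3 / 2" "sqrt (real m)"] by (simp add: real_sqrt_mult)
  qed
  finally have "real b + (real b' + (real w' + 2)) \<le> real m"
    using greedy_binom_bounds[OF bw] greedy_binom_bounds[OF bw'] assms by linarith
  then have "b + (b' + (w' + 2)) \<le> m" by linarith
  then show ?thesis
    using binom_sum_mono binom_sum_add[OF binom_sum_add[OF binom_sum_linear[of w'], of b'], of b]
      bw(1) bw'(1) by simp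
qed

subsection \<open>Newton's identity for the principal specialisation\<close>

text \<open>With \<open>p i\<close> the inverse of \<open>1 - q ^ i\<close>, this is the elementary
  symmetric function of \<open>1, q, q^2, ...\<close>, that is \<open>q ^ (l choose 2)\<close>
  divided by the product of \<open>1 - q ^ i\<close> for \<open>1 \<le> i \<le> l\<close>. The
  inverses are an argument, so that the identity below makes sense in any commutative ring.\<close>

fun q_elem :: "'a::comm_ring_1 \<Rightarrow> (nat \<Rightarrow> 'a) \<Rightarrow> nat \<Rightarrow> 'a" where
  "q_elem q p 0 = 1"
| "q_elem q p (Suc l) = q ^ l * p (Suc l) * q_elem q p l"

text \<open>Multiplying the right-hand side \<open>?S (Suc l)\<close> by
  \<open>1 - q ^ Suc l\<close> makes it collapse to \<open>q ^ l * (?e l + ?S l)\<close>. The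
  induction hypothesis turns this into \<open>Suc l\<close> times \<open>q ^ l * ?e l\<close>, and
  multiplication by \<open>p (Suc l)\<close> undoes the first factor.\<close>

lemma q_elem_newton:
  fixes q :: "'a::comm_ring_1"
  assumes p: "\<And>i. (1 - q ^ Suc i) * p (Suc i) = 1"
  shows "of_nat l * q_elem q p l = (\<Sum>i<l. (-1) ^ i * q_elem q p (l - Suc i) * p (Suc i))"
proof (induction l)
  case 0
  show ?case by simp
next
  case (Suc l)
  let ?e = "q_elem q p"
  let ?S = "\<lambda>l. \<Sum>i<l. (-1) ^ i * ?e (l - Suc i) * p (Suc i)"
  have e_Suc: "(1 - q ^ Suc j) * ?e (Suc j) = q ^ j * ?e j" for j
  proof -
    have "(1 - q ^ Suc j) * ?e (Suc j) = q ^ j * ?e j * ((1 - q ^ Suc j) * p (Suc j))"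
      by (simp only: q_elem.simps) (simp only: mult_ac)
    then show ?thesis by (simp only: p mult_1_right)
  qed
  \<comment> \<open>The factor is split so that one summand cancels \<open>p (Suc i)\<close> and the
    other lowers the index of \<open>?e\<close> through \<open>e_Suc\<close>.\<close>
  have head: "(1 - q ^ Suc l) * (?e (l - i) * p (Suc i))
      = q ^ (l - i) * ?e (l - i) + (1 - q ^ (l - i)) * ?e (l - i) * p (Suc i)" if "i \<le> l" for i
  proof -
    have "q ^ Suc l = q ^ (l - i) * q ^ Suc i"
      using that by (simp flip: power_add power_Suc)
    then have "1 - q ^ Suc l = q ^ (l - i) * (1 - q ^ Suc i) + (1 - q ^ (l - i))"
      by (simp only: right_diff_distrib) simp
    then have "(1 - q ^ Suc l) * (?e (l - i) * p (Suc i))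
      = q ^ (l - i) * ?e (l - i) * ((1 - q ^ Suc i) * p (Suc i)) + (1 - q ^ (l - i)) * ?e (l - i) * p (Suc i)"
      by (simp only: distrib_left distrib_right mult_ac)
    then show ?thesis by (simp only: p mult_1_right)
  qed
  have "(1 - q ^ Suc l) * ?S (Suc l)
      = (\<Sum>i<Suc l. (-1) ^ i * ((1 - q ^ Suc l) * (?e (l - i) * p (Suc i))))"
    by (simp only: sum_distrib_left diff_Suc_Suc) (simp only: mult_ac)
  also have "\<dots> = (\<Sum>i<Suc l. (-1) ^ i * (q ^ (l - i) * ?e (l - i)))
      + (\<Sum>i<Suc l. (-1) ^ i * ((1 - q ^ (l - i)) * ?e (l - i) * p (Suc i)))"
    by (simp only: sum.distrib[symmetric] ring_distribs(1)[symmetric])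
       (rule sum.cong, simp, simp only: head less_Suc_eq_le lessThan_iff)
  \<comment> \<open>The term \<open>i = l\<close> vanishes because of
    \<open>1 - q ^ 0\<close>.\<close>
  also have "(\<Sum>i<Suc l. (-1) ^ i * ((1 - q ^ (l - i)) * ?e (l - i) * p (Suc i)))
      = (\<Sum>i<l. (-1) ^ i * (q ^ (l - Suc i) * ?e (l - Suc i) * p (Suc i)))"
  proof -
    have "(1 - q ^ (l - i)) * ?e (l - i) = q ^ (l - Suc i) * ?e (l - Suc i)" if "i < l" for i
      using e_Suc[of "l - Suc i"] that by (simp only: Suc_diff_Suc)
    then show ?thesis by simp
  qed
  also have "(\<Sum>i<Suc l. (-1) ^ i * (q ^ (l - i) * ?e (l - i)))
      = q ^ l * ?e l - (\<Sum>i<l. (-1) ^ i * (q ^ (l - Suc i) * ?e (l - Suc i)))"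
    by (simp only: sum.lessThan_Suc_shift) (simp add: sum_negf)
  also have "q ^ l * ?e l - (\<Sum>i<l. (-1) ^ i * (q ^ (l - Suc i) * ?e (l - Suc i)))
      + (\<Sum>i<l. (-1) ^ i * (q ^ (l - Suc i) * ?e (l - Suc i) * p (Suc i)))
      = q ^ l * ?e l - (\<Sum>i<l. (-1) ^ i * (q ^ (l - Suc i) * ?e (l - Suc i) * (1 - p (Suc i))))"
    by (simp add: algebra_simps sum_subtractf sum.distrib)
  also have "(\<Sum>i<l. (-1) ^ i * (q ^ (l - Suc i) * ?e (l - Suc i) * (1 - p (Suc i))))
      = - (q ^ l) * ?S l"
  proof -
    have "q ^ (l - Suc i) * (1 - p (Suc i)) = - (q ^ l) * p (Suc i)" if "i < l" for i
    proof -
      have "1 - p (Suc i) = - (q ^ Suc i) * p (Suc i)"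
        using p[of i] by (simp add: algebra_simps)
      moreover have "q ^ l = q ^ (l - Suc i) * q ^ Suc i"
        using that by (simp flip: power_add power_Suc)
      ultimately show ?thesis by (simp only: mult_minus_left mult_minus_right mult.assoc)
    qed
    then have "((-1) ^ i * ?e (l - Suc i)) * (q ^ (l - Suc i) * (1 - p (Suc i)))
      = ((-1) ^ i * ?e (l - Suc i)) * (- (q ^ l) * p (Suc i))" if "i < l" for i
      by (simp only: that)
    then show ?thesis
      by (simp only: sum_distrib_left) (rule sum.cong, simp, simp only: lessThan_iff mult_ac)
  qed
  finally have "(1 - q ^ Suc l) * ?S (Suc l) = q ^ l * (?e l + ?S l)"
    by (simp only: mult_minus_left diff_minus_eq_add distrib_left)
  also have "\<dots> = of_nat (Suc l) * (q ^ l * ?e l)"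
    by (simp only: Suc.IH[symmetric]) (simp add: algebra_simps)
  finally have "p (Suc l) * ((1 - q ^ Suc l) * ?S (Suc l)) = of_nat (Suc l) * ?e (Suc l)"
    by (simp only: q_elem.simps) (simp only: mult_ac)
  moreover have "p (Suc l) * ((1 - q ^ Suc l) * ?S (Suc l)) = ((1 - q ^ Suc l) * p (Suc l)) * ?S (Suc l)"
    by (simp only: mult_ac)
  ultimately show ?case by (simp only: p mult_1_left)
qed

subsection \<open>Characters of monomial matrices\<close>

definition monomial_mat :: "nat \<Rightarrow> (nat \<Rightarrow> nat) \<Rightarrow> (nat \<Rightarrow> complex) \<Rightarrow> complex mat" where
  "monomial_mat n \<sigma> w = mat n n (\<lambda>(i, j). if i = \<sigma> j then w j else 0)"

text \<open>For a permutation \<open>\<sigma>\<close> and non-zero weights, these are the exponent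
  vectors of the monomials of degree \<open>r\<close> that \<open>monomial_mat n \<sigma> w\<close>
  sends to multiples of themselves. All other monomials have diagonal entry 0 in the trace.\<close>

definition fixed_exponents :: "nat \<Rightarrow> (nat \<Rightarrow> nat) \<Rightarrow> nat \<Rightarrow> (nat \<Rightarrow> nat) set" where
  "fixed_exponents n \<sigma> r =
     {f. (\<forall>i\<ge>n. f i = 0) \<and> (\<forall>j<n. f (\<sigma> j) = f j) \<and> (\<Sum>i<n. f i) = r}"

definition monomial_series :: "nat \<Rightarrow> (nat \<Rightarrow> nat) \<Rightarrow> (nat \<Rightarrow> complex) \<Rightarrow> complex fps" where
  "monomial_series n \<sigma> w = Abs_fps (\<lambda>r. \<Sum>f\<in>fixed_exponents n \<sigma> r. \<Prod>j<n. w j ^ f j)"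

lemma monomial_mat_in_group:
  assumes \<sigma>: "bij_betw \<sigma> {..<n} {..<n}" and w: "\<And>j. j < n \<Longrightarrow> w j ^ k = 1" and k: "k \<ge> 1"
  shows "monomial_mat n \<sigma> w \<in> gen_sym_group n k"
proof -
  have nz: "w j \<noteq> 0" if "j < n" for j
    using w[OF that] k by (auto simp: power_0_left)
  have less: "\<sigma> j < n" if "j < n" for j
    using \<sigma> that by (auto simp: bij_betw_def)
  have "\<exists>!j. j < n \<and> \<sigma> j = i" if "i < n" for i
  proof -
    have "i \<in> \<sigma> ` {..<n}" using \<sigma> that by (simp add: bij_betw_def)
    then obtain j where "j < n" "\<sigma> j = i" by auto
    then show ?thesis
      using \<sigma> by (auto simp: bij_betw_def inj_on_def)
  qed
  moreover have "j < n \<and> monomial_mat n \<sigma> w $$ (i, j) \<noteq> 0 \<longleftrightarrow> j < n \<and> \<sigma> j = i" if "i < n" for i j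
    using that nz by (auto simp: monomial_mat_def split: if_splits)
  ultimately have row: "\<exists>!j. j < n \<and> monomial_mat n \<sigma> w $$ (i, j) \<noteq> 0" if "i < n" for i
    using that by simp
  have col: "\<exists>!i. i < n \<and> monomial_mat n \<sigma> w $$ (i, j) \<noteq> 0" if "j < n" for j
    using that nz less by (auto simp: monomial_mat_def cong: conj_cong)
  have "monomial_mat n \<sigma> w \<in> carrier_mat n n"
    by (simp add: monomial_mat_def)
  moreover have "monomial_mat n \<sigma> w $$ (i, j) ^ k = 1"
    if "i < n" "j < n" "monomial_mat n \<sigma> w $$ (i, j) \<noteq> 0" for i j
    using that w by (simp add: monomial_mat_def split: if_splits)
  ultimately show ?thesis
    using row col unfolding gen_sym_group_def by blast
qed

lemma vec_to_poly_monomial: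
  assumes "j < n" "\<sigma> j < n"
  shows "vec_to_poly (monomial_mat n \<sigma> w *\<^sub>v unit_vec n j)
    = Poly_Mapping.single (Poly_Mapping.single (\<sigma> j) 1) (w j)"
proof -
  have "monomial_mat n \<sigma> w *\<^sub>v unit_vec n j = vec n (\<lambda>i. if i = \<sigma> j then w j else 0)"
    using assms by (intro eq_vecI) (auto simp: monomial_mat_def)
  then show ?thesis
    using assms
    by (simp add: vec_to_poly_def if_distrib[of "\<lambda>c. poly_scale c _"] cong: if_cong)
       (simp add: poly_scale_def poly_var_def mult_single)
qed

lemma single_power:
  fixes c :: "'b::comm_semiring_1"
  shows "Poly_Mapping.single (Poly_Mapping.single i 1) c ^ e
    = Poly_Mapping.single (Poly_Mapping.single i e) (c ^ e)"
  by (induction e) (simp_all add: mult_single flip: single_add)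

lemma prod_single:
  fixes c :: "'i \<Rightarrow> 'b::comm_semiring_1"
  shows "finite A \<Longrightarrow> (\<Prod>j\<in>A. Poly_Mapping.single (m j) (c j))
    = Poly_Mapping.single (\<Sum>j\<in>A. m j) (\<Prod>j\<in>A. c j)"
  by (induction rule: finite_induct) (simp_all add: mult_single)

lemma sym_character_monomial_mat:
  assumes \<sigma>: "bij_betw \<sigma> {..<n} {..<n}" and w: "\<And>j. j < n \<Longrightarrow> w j ^ k = 1" and k: "k \<ge> 1"
  shows "sym_character n k r (monomial_mat n \<sigma> w) = monomial_series n \<sigma> w $ r"
proof -
  have less: "\<sigma> j < n" if "j < n" for j
    using \<sigma> that by (auto simp: bij_betw_def)
  have surj: "\<exists>j<n. \<sigma> j = i" if "i < n" for i
    using \<sigma> that unfolding bij_betw_def by (metis imageE lessThan_iff)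
  have diag: "Poly_Mapping.lookup (sym_action n (monomial_mat n \<sigma> w) (poly_monom m)) m
      = (if \<forall>j<n. Poly_Mapping.lookup m (\<sigma> j) = Poly_Mapping.lookup m j
         then \<Prod>j<n. w j ^ Poly_Mapping.lookup m j else 0)"
    if m: "m \<in> exponents n r" for m
  proof -
    \<comment> \<open>The exponent vector of the image of the monomial \<open>m\<close>: the
      exponent at \<open>j\<close> moves to \<open>\<sigma> j\<close>.\<close>
    let ?m = "\<Sum>j<n. Poly_Mapping.single (\<sigma> j) (Poly_Mapping.lookup m j)"
    have lookup_m: "Poly_Mapping.lookup ?m (\<sigma> j) = Poly_Mapping.lookup m j" if "j < n" for j
    proof -
      have "Poly_Mapping.lookup ?m (\<sigma> j) = (\<Sum>i<n. if i = j then Poly_Mapping.lookup m i else 0)"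
        unfolding lookup_sum
        by (rule sum.cong) (use \<sigma> that in \<open>auto simp: lookup_single when_def bij_betw_def inj_on_def\<close>)
      then show ?thesis using that by simp
    qed
    have "?m = m \<longleftrightarrow> (\<forall>j<n. Poly_Mapping.lookup m (\<sigma> j) = Poly_Mapping.lookup m j)"
    proof
      show "\<forall>j<n. Poly_Mapping.lookup m (\<sigma> j) = Poly_Mapping.lookup m j" if "?m = m"
        using lookup_m that by simp
      assume inv: "\<forall>j<n. Poly_Mapping.lookup m (\<sigma> j) = Poly_Mapping.lookup m j"
      show "?m = m"
      proof (rule poly_mapping_eqI)
        fix i
        show "Poly_Mapping.lookup ?m i = Poly_Mapping.lookup m i"
        proof (cases "i < n")
          case True
          then show ?thesis using surj lookup_m inv by metis
        next
          case False
          then have "Poly_Mapping.lookup m i = 0"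
            using m by (auto simp: exponents_def in_keys_iff)
          moreover have "Poly_Mapping.lookup ?m i = 0"
            using False less by (auto simp: lookup_sum lookup_single when_def intro!: sum.neutral)
          ultimately show ?thesis by simp
        qed
      qed
    qed
    then have "Poly_Mapping.lookup (Poly_Mapping.single ?m c) m
      = (if \<forall>j<n. Poly_Mapping.lookup m (\<sigma> j) = Poly_Mapping.lookup m j then c else 0)" for c :: complex
      by (simp only: lookup_single when_def)
    moreover have "sym_action n (monomial_mat n \<sigma> w) (poly_monom m)
      = Poly_Mapping.single ?m (\<Prod>j<n. w j ^ Poly_Mapping.lookup m j)"
      using less
      by (simp add: sym_action_def poly_monom_def vec_to_poly_monomial single_power prod_single
          del: One_nat_def)
    ultimately show ?thesis by (simp only:)
  qed
  have bij: "bij_betw Poly_Mapping.lookup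
     {m \<in> exponents n r. \<forall>j<n. Poly_Mapping.lookup m (\<sigma> j) = Poly_Mapping.lookup m j}
     (fixed_exponents n \<sigma> r)"
    (is "bij_betw _ ?M _")
  proof -
    have "\<exists>m\<in>?M. f = Poly_Mapping.lookup m" if f: "f \<in> fixed_exponents n \<sigma> r" for f
    proof
      have "i < n" if "f i \<noteq> 0" for i
        using f that by (cases "i < n") (auto simp: fixed_exponents_def)
      then have "{i. f i \<noteq> 0} \<subseteq> {..<n}" by blast
      moreover from this have "finite {i. f i \<noteq> 0}" by (rule finite_subset) simp
      then have eq: "Poly_Mapping.lookup (Abs_poly_mapping f) = f" by simp
      moreover have "Poly_Mapping.keys (Abs_poly_mapping f) = {i. f i \<noteq> 0}"
        by (simp add: keys.rep_eq eq)
      ultimately show "Abs_poly_mapping f \<in> ?M"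
        using f by (simp add: fixed_exponents_def exponents_def)
      show "f = Poly_Mapping.lookup (Abs_poly_mapping f)" by (rule eq[symmetric])
    qed
    moreover have "Poly_Mapping.lookup m \<in> fixed_exponents n \<sigma> r" if "m \<in> ?M" for m
    proof -
      have "Poly_Mapping.lookup m i = 0" if "i \<ge> n" for i
        using \<open>m \<in> ?M\<close> that by (auto simp: exponents_def subset_iff in_keys_iff)
      then show ?thesis using that by (simp add: fixed_exponents_def exponents_def)
    qed
    ultimately have "Poly_Mapping.lookup ` ?M = fixed_exponents n \<sigma> r" by blast
    then show ?thesis
      by (simp add: bij_betw_def inj_on_def poly_mapping.lookup_inject)
  qed
  have "sym_character n k r (monomial_mat n \<sigma> w)
      = (\<Sum>m\<in>?M. \<Prod>j<n. w j ^ Poly_Mapping.lookup m j)"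
    using monomial_mat_in_group[OF assms]
    by (simp add: sym_character_def diag sum.If_cases finite_exponents Collect_conj_eq)
  also have "\<dots> = (\<Sum>f\<in>fixed_exponents n \<sigma> r. \<Prod>j<n. w j ^ f j)"
    by (rule sum.reindex_bij_betw[OF bij])
  finally show ?thesis by (simp add: monomial_series_def)
qed

lemma finite_fixed_exponents: "finite (fixed_exponents n \<sigma> r)"
proof (rule finite_subset)
  show "finite {f. \<forall>i. (i \<in> {..<n} \<longrightarrow> f i \<in> {..r}) \<and> (i \<notin> {..<n} \<longrightarrow> f i = (0::nat))}"
    by (rule finite_set_of_finite_funs) auto
  show "fixed_exponents n \<sigma> r \<subseteq> {f. \<forall>i. (i \<in> {..<n} \<longrightarrow> f i \<in> {..r}) \<and> (i \<notin> {..<n} \<longrightarrow> f i = 0)}"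
    unfolding fixed_exponents_def by (auto intro: member_le_sum)
qed

section \<open>Appending a cycle to a monomial matrix\<close>

definition append_cycle :: "nat \<Rightarrow> nat \<Rightarrow> (nat \<Rightarrow> nat) \<Rightarrow> nat \<Rightarrow> nat" where
  "append_cycle n l \<sigma> j = (if j < n then \<sigma> j else if j = n + l then n else Suc j)"

lemma bij_betw_append_cycle:
  assumes "bij_betw \<sigma> {..<n} {..<n}"
  shows "bij_betw (append_cycle n l \<sigma>) {..<n + Suc l} {..<n + Suc l}"
proof -
  have "bij_betw (append_cycle n l \<sigma>) {..<n} {..<n}"
    using assms by (rule bij_betw_cong[THEN iffD1, rotated]) (simp add: append_cycle_def)
  moreover have "bij_betw (append_cycle n l \<sigma>) {n..<n + Suc l} {n..<n + Suc l}"
    unfolding bij_betw_def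
  proof
    show inj: "inj_on (append_cycle n l \<sigma>) {n..<n + Suc l}"
      by (auto simp: append_cycle_def inj_on_def)
    show "append_cycle n l \<sigma> ` {n..<n + Suc l} = {n..<n + Suc l}"
      by (rule endo_inj_surj[OF _ _ inj]) (auto simp: append_cycle_def)
  qed
  ultimately have "bij_betw (append_cycle n l \<sigma>) ({..<n} \<union> {n..<n + Suc l}) ({..<n} \<union> {n..<n + Suc l})"
    by (rule bij_betw_combine) auto
  moreover have "{..<n} \<union> {n..<n + Suc l} = {..<n + Suc l}" by auto
  ultimately show ?thesis by simp
qed


text \<open>Only the product of the entries along a cycle matters for the character, so a single
  entry carries \<open>\<zeta>\<close>.\<close>

definition append_weight :: "nat \<Rightarrow> complex \<Rightarrow> (nat \<Rightarrow> complex) \<Rightarrow> nat \<Rightarrow> complex" where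
  "append_weight n \<zeta> w j = (if j < n then w j else if j = n then \<zeta> else 1)"

lemma fixed_exponents_const_on_cycle:
  assumes "f \<in> fixed_exponents (n + Suc l) (append_cycle n l \<sigma>) r" "n \<le> j" "j \<le> n + l"
  shows "f j = f n"
  using assms(2,3)
proof (induction j rule: dec_induct)
  case base
  show ?case by simp
next
  case (step j)
  then have "f (append_cycle n l \<sigma> j) = f j"
    using assms(1) by (simp add: fixed_exponents_def)
  then show ?case using step by (simp add: append_cycle_def)
qed

text \<open>An invariant vector is constant on the new cycle. If that constant is 0, the vector
  comes from the old permutation; otherwise subtracting the indicator \<open>b\<close> of the cycle
  leaves an invariant vector whose degree is smaller by \<open>Suc l\<close>.\<close>

lemma fixed_exponents_append:
  fixes n l :: nat
  assumes \<sigma>: "bij_betw \<sigma> {..<n} {..<n}"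
  defines "\<tau> \<equiv> append_cycle n l \<sigma>"
    and "b \<equiv> \<lambda>i. if n \<le> i \<and> i \<le> n + l then 1 else (0::nat)"
  shows "{f \<in> fixed_exponents (n + Suc l) \<tau> r. f n = 0} = fixed_exponents n \<sigma> r"
    and "{f \<in> fixed_exponents (n + Suc l) \<tau> r. f n \<noteq> 0} =
      (if r < Suc l then {} else (\<lambda>f i. f i + b i) ` fixed_exponents (n + Suc l) \<tau> (r - Suc l))"
proof -
  let ?E = "fixed_exponents (n + Suc l) \<tau>"
  have less: "\<sigma> j < n" if "j < n" for j
    using \<sigma> that by (auto simp: bij_betw_def)
  have sum_n: "(\<Sum>i<n + Suc l. f i) = (\<Sum>i<n. f i)" if "\<forall>i\<ge>n. f i = 0" for f :: "nat \<Rightarrow> nat"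
    by (rule sum.mono_neutral_right) (use that in auto)
  have zero: "f i = 0" if "f \<in> ?E r" "f n = 0" "i \<ge> n" for f i
  proof (cases "i \<le> n + l")
    case True
    then show ?thesis
      using fixed_exponents_const_on_cycle[of f n l \<sigma> r i] that by (simp add: \<tau>_def)
  next
    case False
    then show ?thesis using that by (simp add: fixed_exponents_def)
  qed
  show "{f \<in> ?E r. f n = 0} = fixed_exponents n \<sigma> r"
  proof (intro Set.set_eqI iffI)
    fix f assume f: "f \<in> {f \<in> ?E r. f n = 0}"
    then have z: "\<forall>i\<ge>n. f i = 0" using zero by blast
    moreover have "f (\<sigma> j) = f j" if "j < n" for j
    proof -
      have "f (\<tau> j) = f j" using f that by (simp add: fixed_exponents_def)
      then show ?thesis using that by (simp add: \<tau>_def append_cycle_def)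
    qed
    ultimately show "f \<in> fixed_exponents n \<sigma> r"
      using f sum_n[OF z] by (simp add: fixed_exponents_def)
  next
    fix f assume f: "f \<in> fixed_exponents n \<sigma> r"
    then have z: "\<forall>i\<ge>n. f i = 0" by (simp add: fixed_exponents_def)
    then show "f \<in> {f \<in> ?E r. f n = 0}"
      using f sum_n[OF z] by (auto simp: fixed_exponents_def \<tau>_def append_cycle_def)
  qed
  have sum_b: "(\<Sum>i<n + Suc l. b i) = Suc l"
  proof -
    have "(\<Sum>i<n + Suc l. b i) = (\<Sum>i\<in>{n..n + l}. 1)"
      by (rule sum.mono_neutral_cong_right) (auto simp: b_def)
    then show ?thesis by simp
  qed
  have b_\<tau>: "b (\<tau> j) = b j" if "j < n + Suc l" for j
    using that less[of j] by (cases "j < n") (auto simp: b_def \<tau>_def append_cycle_def)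
  have b_outside: "b i = 0" if "i \<ge> n + Suc l" for i
    using that by (simp add: b_def)
  show "{f \<in> ?E r. f n \<noteq> 0} =
      (if r < Suc l then {} else (\<lambda>f i. f i + b i) ` ?E (r - Suc l))"
  proof (intro Set.set_eqI iffI)
    fix f assume "f \<in> {f \<in> ?E r. f n \<noteq> 0}"
    then have f: "f \<in> ?E r" "f n \<noteq> 0" by auto
    \<comment> \<open>Constant and non-zero on the cycle, \<open>f\<close> is at least 1 there, so
      the truncated subtraction is exact.\<close>
    have b_le: "b i \<le> f i" for i
      using fixed_exponents_const_on_cycle[of f n l \<sigma> r i] f by (auto simp: b_def \<tau>_def)
    have eq: "f = (\<lambda>i. (f i - b i) + b i)"
      using b_le by auto
    have "(\<Sum>i<n + Suc l. f i) = (\<Sum>i<n + Suc l. f i - b i) + (\<Sum>i<n + Suc l. b i)"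
      by (simp only: sum.distrib[symmetric] le_add_diff_inverse2[OF b_le])
    then have r: "r = (\<Sum>i<n + Suc l. f i - b i) + Suc l"
      using f(1) sum_b by (simp add: fixed_exponents_def)
    then have "(\<lambda>i. f i - b i) \<in> ?E (r - Suc l)"
      using f b_\<tau> b_outside by (simp add: fixed_exponents_def)
    then have "f \<in> (\<lambda>f i. f i + b i) ` ?E (r - Suc l)"
      by (rule rev_image_eqI) (rule eq)
    moreover have "\<not> r < Suc l" using r by simp
    ultimately show "f \<in> (if r < Suc l then {} else (\<lambda>f i. f i + b i) ` ?E (r - Suc l))"
      by simp
  next
    fix f assume "f \<in> (if r < Suc l then {} else (\<lambda>f i. f i + b i) ` ?E (r - Suc l))"
    then obtain g where g: "g \<in> ?E (r - Suc l)" "f = (\<lambda>i. g i + b i)" and r: "r \<ge> Suc l"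
      by (auto split: if_splits)
    have "(\<Sum>i<n + Suc l. f i) = (\<Sum>i<n + Suc l. g i) + (\<Sum>i<n + Suc l. b i)"
      unfolding g(2) by (rule sum.distrib)
    moreover have "(\<Sum>i<n + Suc l. g i) = r - Suc l"
      using g(1) by (simp add: fixed_exponents_def)
    ultimately have "(\<Sum>i<n + Suc l. f i) = r"
      using r sum_b by simp
    moreover have "f i = 0" if "i \<ge> n + Suc l" for i
      using g(1) b_outside[OF that] that by (simp add: g(2) fixed_exponents_def)
    moreover have "f (\<tau> j) = f j" if "j < n + Suc l" for j
      using g(1) b_\<tau>[OF that] that by (simp add: g(2) fixed_exponents_def)
    ultimately have "f \<in> ?E r"
      unfolding fixed_exponents_def by blast
    moreover have "f n \<noteq> 0" by (simp add: g(2) b_def)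
    ultimately show "f \<in> {f \<in> ?E r. f n \<noteq> 0}" by blast
  qed
qed

text \<open>One factor of Molien's product. Splitting by the value on the new cycle shows that the
  longer series equals the old one plus \<open>\<zeta> X^(Suc l)\<close> times itself.\<close>

lemma monomial_series_append:
  assumes \<sigma>: "bij_betw \<sigma> {..<n} {..<n}"
  shows "(1 - fps_const \<zeta> * fps_X ^ Suc l)
      * monomial_series (n + Suc l) (append_cycle n l \<sigma>) (append_weight n \<zeta> w)
    = monomial_series n \<sigma> w"
proof (rule fps_ext)
  fix r
  let ?b = "\<lambda>i. if n \<le> i \<and> i \<le> n + l then 1 else (0::nat)"
  let ?w = "append_weight n \<zeta> w"
  let ?E = "fixed_exponents (n + Suc l) (append_cycle n l \<sigma>)"
  let ?F = "monomial_series (n + Suc l) (append_cycle n l \<sigma>) ?w"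
  let ?P = "\<lambda>f. \<Prod>j<n + Suc l. ?w j ^ f j"
  have P_b: "?P (\<lambda>i. f i + ?b i) = \<zeta> * ?P f" for f
  proof -
    have "(\<Prod>j<n + Suc l. ?w j ^ ?b j) = (\<Prod>j<n + Suc l. if j = n then \<zeta> else 1)"
      by (rule prod.cong) (auto simp: append_weight_def)
    then show ?thesis
      by (simp add: power_add prod.distrib del: prod.lessThan_Suc add_Suc_right)
  qed
  have "?F $ r = (\<Sum>f\<in>?E r. ?P f)"
    by (simp add: monomial_series_def)
  also have "\<dots> = (\<Sum>f\<in>{f \<in> ?E r. f n = 0} \<union> {f \<in> ?E r. f n \<noteq> 0}. ?P f)"
    by (rule sum.cong) auto
  also have "\<dots> = (\<Sum>f | f \<in> ?E r \<and> f n = 0. ?P f) + (\<Sum>f | f \<in> ?E r \<and> f n \<noteq> 0. ?P f)"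
    by (rule sum.union_disjoint) (auto simp: finite_fixed_exponents)
  also have "(\<Sum>f | f \<in> ?E r \<and> f n = 0. ?P f) = monomial_series n \<sigma> w $ r"
  proof -
    have "?P f = (\<Prod>j<n. w j ^ f j)" if "f \<in> fixed_exponents n \<sigma> r" for f
    proof -
      have "?P f = (\<Prod>j<n. ?w j ^ f j)"
        by (rule prod.mono_neutral_right) (use that in \<open>auto simp: fixed_exponents_def\<close>)
      then show ?thesis by (simp add: append_weight_def)
    qed
    then show ?thesis
      by (simp only: fixed_exponents_append(1)[OF \<sigma>] monomial_series_def fps_nth_Abs_fps cong: sum.cong)
  qed
  also have "(\<Sum>f | f \<in> ?E r \<and> f n \<noteq> 0. ?P f) = (if r < Suc l then 0 else \<zeta> * ?F $ (r - Suc l))"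
  proof (cases "r < Suc l")
    case True
    then show ?thesis by (simp only: fixed_exponents_append(2)[OF \<sigma>] if_True sum.empty)
  next
    case False
    have "inj_on (\<lambda>f i. f i + ?b i) A" for A :: "(nat \<Rightarrow> nat) set"
      by (auto simp: inj_on_def fun_eq_iff)
    then have "(\<Sum>f\<in>(\<lambda>f i. f i + ?b i) ` ?E (r - Suc l). ?P f) = (\<Sum>f\<in>?E (r - Suc l). \<zeta> * ?P f)"
      by (subst sum.reindex) (simp_all only: o_def P_b)
    then show ?thesis
      using False by (simp only: fixed_exponents_append(2)[OF \<sigma>] if_False monomial_series_def
          fps_nth_Abs_fps sum_distrib_left)
  qed
  finally show "((1 - fps_const \<zeta> * fps_X ^ Suc l) * ?F) $ r = monomial_series n \<sigma> w $ r"
    by (simp add: left_diff_distrib mult.assoc fps_X_power_mult_nth del: power_Suc)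
qed

subsection \<open>The span of the generating functions\<close>

global_interpretation fps_space: vector_space "\<lambda>c F. fps_const c * F :: 'a::field fps"
  by unfold_locales (simp_all add: algebra_simps flip: fps_const_add fps_const_mult)

text \<open>For \<open>k \<ge> 1\<close> the generators have the character values of one group
  element as coefficients; relations among the characters are tested on this span.\<close>

definition series_space :: "nat \<Rightarrow> nat \<Rightarrow> complex fps set" where
  "series_space n k = fps_space.span {monomial_series n \<sigma> w |\<sigma> w.
     bij_betw \<sigma> {..<n} {..<n} \<and> (\<forall>j<n. w j ^ k = 1)}"

lemma series_space_0: "1 \<in> series_space 0 k"
proof -
  have "fixed_exponents 0 id r = (if r = 0 then {\<lambda>_. 0} else {})" for r
    by (auto simp: fixed_exponents_def)
  then have "monomial_series 0 id (\<lambda>_. 1) = 1"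
    by (intro fps_ext) (simp add: monomial_series_def)
  then show ?thesis
    unfolding series_space_def by (intro fps_space.span_base) force
qed

text \<open>By linearity only generators matter, and on these the multiplication amounts to
  appending a cycle.\<close>

lemma series_space_cycle:
  assumes F: "F \<in> series_space n k" and \<zeta>: "\<zeta> ^ k = 1"
  shows "F * inverse (1 - fps_const \<zeta> * fps_X ^ Suc l) \<in> series_space (n + Suc l) k"
  using F unfolding series_space_def
proof (rule fps_space.span_induct)
  let ?S = "{monomial_series (n + Suc l) \<sigma> w |\<sigma> w.
     bij_betw \<sigma> {..<n + Suc l} {..<n + Suc l} \<and> (\<forall>j<n + Suc l. w j ^ k = 1)}"
  let ?H = "inverse (1 - fps_const \<zeta> * fps_X ^ Suc l)"
  show "fps_space.subspace {F. F * ?H \<in> fps_space.span ?S}"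
    by (simp add: fps_space.subspace_def distrib_right fps_space.span_add fps_space.span_scale
        fps_space.span_zero mult.assoc)
  show "F * ?H \<in> fps_space.span ?S"
    if F: "F \<in> {monomial_series n \<sigma> w |\<sigma> w. bij_betw \<sigma> {..<n} {..<n} \<and> (\<forall>j<n. w j ^ k = 1)}" for F
  proof -
    obtain \<sigma> w where \<sigma>: "bij_betw \<sigma> {..<n} {..<n}" and w: "\<forall>j<n. w j ^ k = 1"
      and F: "F = monomial_series n \<sigma> w" using F by blast
    let ?G = "monomial_series (n + Suc l) (append_cycle n l \<sigma>) (append_weight n \<zeta> w)"
    have "(1 - fps_const \<zeta> * fps_X ^ Suc l) * ?H = 1"
      by (intro inverse_mult_eq_1') simp
    then have "F * ?H = ?G"
      unfolding F monomial_series_append[OF \<sigma>, of \<zeta> l w, symmetric]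
      by (metis mult.assoc mult.commute mult_1)
    moreover have "?G \<in> ?S"
    proof -
      have "\<forall>j<n + Suc l. append_weight n \<zeta> w j ^ k = 1"
        using w \<zeta> by (simp add: append_weight_def)
      then show ?thesis using bij_betw_append_cycle[OF \<sigma>] by blast
    qed
    ultimately show ?thesis by (simp add: fps_space.span_base)
  qed
qed

section \<open>Averaging over roots of unity\<close>

lemma root_unity_orthogonality:
  fixes a r k :: nat
  assumes "a < k" "r < k"
  defines "\<omega> \<equiv> cis (2 * pi / k)"
  shows "(\<Sum>s<k. \<omega> ^ (s * a) / \<omega> ^ (s * r)) = (if a = r then of_nat k else 0)"
proof -
  define z where "z = \<omega> ^ a / \<omega> ^ r"
  have \<omega>_pow: "\<omega> ^ j = cis (2 * pi * j / k)" for j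
    by (simp add: \<omega>_def Complex.DeMoivre mult_ac)
  have \<omega>0: "\<omega> \<noteq> 0" by (simp add: \<omega>_def)
  have "(\<Sum>s<k. \<omega> ^ (s * a) / \<omega> ^ (s * r)) = (\<Sum>s<k. z ^ s)"
    by (simp add: z_def power_divide mult.commute flip: power_mult)
  also have "\<dots> = (if a = r then of_nat k else 0)"
  proof (cases "a = r")
    case True
    then show ?thesis using \<omega>0 by (simp add: z_def)
  next
    case False
    have "inj_on (\<lambda>j. cis (2 * pi * real j / real k)) {..<k}"
      using bij_betw_roots_unity[of k] assms by (auto simp: bij_betw_def)
    then have z1: "z \<noteq> 1"
      using False assms(1,2) \<omega>0 by (auto simp: z_def \<omega>_pow inj_on_def)
    have "\<omega> ^ k = 1"
      using assms(1) by (simp add: \<omega>_pow)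
    moreover have "(\<omega> ^ j) ^ k = (\<omega> ^ k) ^ j" for j
      by (simp only: power_mult[symmetric] mult.commute)
    ultimately have "z ^ k = 1"
      by (simp add: z_def power_divide)
    then show ?thesis using False z1 by (simp add: geometric_sum)
  qed
  finally show ?thesis .
qed

lemma fps_const_sum: "fps_const (\<Sum>a\<in>A. f a) = (\<Sum>a\<in>A. fps_const (f a))"
  by (rule fps_ext) (simp add: fps_sum_nth)

text \<open>Averaging over the \<open>k\<close>-th roots of unity \<open>\<zeta>\<close> isolates the exponents congruent to \<open>r\<close>
  modulo \<open>k\<close> in the geometric series of \<open>\<zeta> X\<^sup>l\<close>.\<close>

lemma series_space_average:
  assumes F: "F \<in> series_space n k" and r: "r < k"
  shows "F * (fps_X ^ (Suc l * r) * inverse (1 - fps_X ^ (Suc l * k))) \<in> series_space (n + Suc l) k"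
proof -
  define \<omega> where "\<omega> = cis (2 * pi / k)"
  define y :: "complex fps" where "y = fps_X ^ Suc l"
  define H where "H = (\<lambda>s. inverse (1 - fps_const (\<omega> ^ s) * y))"
  have k: "k > 0" using r by simp
  have \<omega>k: "\<omega> ^ k = 1" using k by (simp add: \<omega>_def Complex.DeMoivre)
  \<comment> \<open>Since \<open>(\<omega>^s y)^k = y^k\<close>, all these geometric series share
    the denominator \<open>1 - y ^ k\<close>.\<close>
  have H: "H s = inverse (1 - y ^ k) * (\<Sum>a<k. fps_const (\<omega> ^ (s * a)) * y ^ a)" for s
  proof -
    let ?z = "fps_const (\<omega> ^ s) * y"
    have "?z ^ k = y ^ k"
      using \<omega>k by (simp add: power_mult_distrib fps_const_power flip: power_mult)
        (simp add: mult.commute[of s] power_mult)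
    then have geom: "1 - y ^ k = (1 - ?z) * (\<Sum>a<k. ?z ^ a)"
      using one_diff_power_eq[of ?z k] by simp
    have H_inv: "H s * (1 - ?z) = 1"
      unfolding H_def by (rule inverse_mult_eq_1) (simp add: y_def)
    have "inverse (1 - y ^ k) * (1 - y ^ k) = 1"
      using k by (intro inverse_mult_eq_1) (simp add: y_def fps_power_zeroth power_0_left)
    then have "H s = H s * (inverse (1 - y ^ k) * ((1 - ?z) * (\<Sum>a<k. ?z ^ a)))"
      unfolding geom by simp
    also have "\<dots> = (H s * (1 - ?z)) * (inverse (1 - y ^ k) * (\<Sum>a<k. ?z ^ a))"
      by (simp only: mult_ac)
    finally have "H s = inverse (1 - y ^ k) * (\<Sum>a<k. ?z ^ a)"
      by (simp only: H_inv mult_1_left)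
    moreover have "(\<Sum>a<k. ?z ^ a) = (\<Sum>a<k. fps_const (\<omega> ^ (s * a)) * y ^ a)"
      by (simp add: power_mult_distrib fps_const_power flip: power_mult)
    ultimately show ?thesis by simp
  qed
  have "(\<Sum>s<k. fps_const (1 / \<omega> ^ (s * r)) * H s)
      = inverse (1 - y ^ k) * (\<Sum>a<k. fps_const (\<Sum>s<k. \<omega> ^ (s * a) / \<omega> ^ (s * r)) * y ^ a)"
  proof -
    have "(\<Sum>s<k. fps_const (1 / \<omega> ^ (s * r)) * H s)
      = inverse (1 - y ^ k) * (\<Sum>s<k. \<Sum>a<k. fps_const (\<omega> ^ (s * a) / \<omega> ^ (s * r)) * y ^ a)"
      unfolding H sum_distrib_left
      by (intro sum.cong refl) (simp add: mult.left_commute[of "fps_const (1 / _)"] mult.assoc[symmetric])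
    also have "(\<Sum>s<k. \<Sum>a<k. fps_const (\<omega> ^ (s * a) / \<omega> ^ (s * r)) * y ^ a)
      = (\<Sum>a<k. fps_const (\<Sum>s<k. \<omega> ^ (s * a) / \<omega> ^ (s * r)) * y ^ a)"
      by (subst sum.swap) (simp add: fps_const_sum flip: sum_distrib_right)
    finally show ?thesis .
  qed
  also have "\<dots> = inverse (1 - y ^ k) * (\<Sum>a<k. if a = r then fps_const (of_nat k) * y ^ a else 0)"
    using r by (intro arg_cong2[where f = "(*)"] sum.cong refl)
      (simp add: \<omega>_def root_unity_orthogonality)
  also have "\<dots> = inverse (1 - y ^ k) * (fps_const (of_nat k) * y ^ r)"
    using r by simp
  finally have avg: "fps_const (1 / of_nat k) * (\<Sum>s<k. fps_const (1 / \<omega> ^ (s * r)) * H s)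
      = y ^ r * inverse (1 - y ^ k)"
    using k by (simp add: mult_ac fps_const_mult[symmetric] del: fps_const_mult)
  have "(\<omega> ^ s) ^ k = (\<omega> ^ k) ^ s" for s
    by (simp only: power_mult[symmetric] mult.commute)
  then have "F * H s \<in> series_space (n + Suc l) k" for s
    unfolding H_def y_def using \<omega>k
    by (intro series_space_cycle[OF F]) simp
  then have "fps_const (1 / of_nat k) * (\<Sum>s<k. fps_const (1 / \<omega> ^ (s * r)) * (F * H s))
      \<in> series_space (n + Suc l) k"
    unfolding series_space_def
    by (intro fps_space.span_scale fps_space.span_sum)
  also have "fps_const (1 / of_nat k) * (\<Sum>s<k. fps_const (1 / \<omega> ^ (s * r)) * (F * H s))
      = F * (fps_const (1 / of_nat k) * (\<Sum>s<k. fps_const (1 / \<omega> ^ (s * r)) * H s))"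
    by (simp add: sum_distrib_left mult_ac)
  also have "\<dots> = F * (fps_X ^ (Suc l * r) * inverse (1 - fps_X ^ (Suc l * k)))"
    unfolding avg unfolding y_def power_mult by simp
  finally show ?thesis .
qed

section \<open>Elementary symmetric series and valuations\<close>

definition elem_series :: "nat \<Rightarrow> nat \<Rightarrow> complex fps" where
  "elem_series k = q_elem (fps_X ^ k) (\<lambda>i. inverse (1 - (fps_X ^ k) ^ i))"

text \<open>Newton's identity writes \<open>l * elem_series k l\<close> through products of
  \<open>?p (Suc i)\<close> and \<open>elem_series k (l - Suc i)\<close>. The first factor uses
  \<open>Suc i\<close> rows, by averaging with residue 0, and the second uses the other
  \<open>l - Suc i\<close> by induction. As \<open>F\<close> absorbs the first factor, the induction
  generalises over \<open>F\<close> and \<open>n\<close>.\<close>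

lemma series_space_elem:
  assumes k: "k \<ge> 1" and F: "F \<in> series_space n k"
  shows "F * elem_series k l \<in> series_space (n + l) k"
  using F
proof (induction l arbitrary: n F rule: less_induct)
  case (less l)
  let ?p = "\<lambda>i. inverse (1 - (fps_X ^ k) ^ i) :: complex fps"
  show ?case
  proof (cases "l = 0")
    case True
    then show ?thesis using less.prems by (simp add: elem_series_def)
  next
    case False
    have "(1 - (fps_X ^ k) ^ Suc i) * ?p (Suc i) = 1" for i
      using k by (intro inverse_mult_eq_1') (simp add: fps_X_power_nth flip: power_mult power_Suc)
    then have newton: "of_nat l * elem_series k l
        = (\<Sum>i<l. (-1) ^ i * elem_series k (l - Suc i) * ?p (Suc i))"
      unfolding elem_series_def by (rule q_elem_newton)
    have "F * ?p (Suc i) * elem_series k (l - Suc i) \<in> series_space (n + l) k" if "i < l" for i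
    proof -
      have "F * ?p (Suc i) \<in> series_space (n + Suc i) k"
        using series_space_average[OF less.prems, of 0 i] k
        by (simp add: mult.commute del: power_Suc flip: power_mult)
      from less.IH[OF _ this, of "l - Suc i"] show ?thesis using that by simp
    qed
    then have "fps_const (1 / of_nat l) * (\<Sum>i<l. fps_const ((-1) ^ i)
        * (F * ?p (Suc i) * elem_series k (l - Suc i))) \<in> series_space (n + l) k"
      unfolding series_space_def
      by (intro fps_space.span_scale fps_space.span_sum) auto
    also have "(\<Sum>i<l. fps_const ((-1) ^ i) * (F * ?p (Suc i) * elem_series k (l - Suc i)))
        = F * (of_nat l * elem_series k l)"
      unfolding newton sum_distrib_left
      by (intro sum.cong refl) (simp add: mult_ac flip: fps_const_power fps_const_neg)
    also have "fps_const (1 / of_nat l) * \<dots> = F * elem_series k l"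
      using False by (simp add: fps_of_nat[symmetric] mult.left_commute)
    finally show ?thesis .
  qed
qed

text \<open>Passing from \<open>l\<close> to \<open>Suc l\<close> multiplies by
  \<open>X^(k * l)\<close> and a unit with constant term 1.\<close>

lemma elem_series_eq:
  assumes "k \<ge> 1"
  shows "\<exists>U. elem_series k l = fps_X ^ (k * (l choose 2)) * U \<and> U $ 0 = 1"
proof (induction l)
  case 0
  show ?case by (intro exI[of _ 1]) (simp add: elem_series_def numeral_2_eq_2)
next
  case (Suc l)
  then obtain U where U: "elem_series k l = fps_X ^ (k * (l choose 2)) * U" "U $ 0 = 1" by blast
  let ?p = "inverse (1 - fps_X ^ (k * Suc l)) :: complex fps"
  have "elem_series k (Suc l) = fps_X ^ (k * l) * ?p * elem_series k l"
    unfolding elem_series_def power_mult by simp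
  also have "\<dots> = fps_X ^ (k * (Suc l choose 2)) * (?p * U)"
    by (simp add: U choose_2_Suc distrib_left power_add mult_ac)
  finally show ?case
    using U(2) assms by (intro exI[of _ "?p * U"]) (simp add: fps_X_power_nth)
qed

lemma series_space_elem_list:
  assumes k: "k \<ge> 1" and F: "F \<in> series_space n k"
  shows "\<exists>U. F * (fps_X ^ (k * (\<Sum>x\<leftarrow>xs. x choose 2)) * U) \<in> series_space (n + sum_list xs) k \<and> U $ 0 = 1"
proof (induction xs)
  case Nil
  show ?case using F by (intro exI[of _ 1]) simp
next
  case (Cons x xs)
  then obtain U where U: "F * (fps_X ^ (k * (\<Sum>x\<leftarrow>xs. x choose 2)) * U) \<in> series_space (n + sum_list xs) k"
    "U $ 0 = 1" by blast
  obtain V where V: "elem_series k x = fps_X ^ (k * (x choose 2)) * V" "V $ 0 = 1"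
    using elem_series_eq[OF k] by blast
  show ?case
    using series_space_elem[OF k U(1), of x] U(2) V(2)
    by (intro exI[of _ "U * V"]) (simp add: V(1) distrib_left power_add mult_ac add_ac)
qed

text \<open>One row is set aside for a cycle of length 1, whose average yields the residue
  \<open>r\<close>; the other \<open>m\<close> rows yield \<open>k * q\<close>.\<close>

lemma series_space_valuation:
  assumes k: "k \<ge> 1" and r: "r < k" and q: "binom_sum m q"
  shows "\<exists>U. fps_X ^ (k * q + r) * U \<in> series_space (Suc m) k \<and> U $ 0 = 1"
proof -
  obtain xs where xs: "sum_list xs \<le> m" "(\<Sum>x\<leftarrow>xs. x choose 2) = q"
    using q unfolding binom_sum_def by blast
  let ?p = "inverse (1 - fps_X ^ k) :: complex fps"
  \<comment> \<open>Parts of size 1 fill the budget to exactly \<open>m\<close> without changing the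
    valuation.\<close>
  let ?ys = "replicate (m - sum_list xs) 1 @ xs"
  have "fps_X ^ r * ?p \<in> series_space (Suc 0) k"
    using series_space_average[OF series_space_0 r, of 0] by simp
  from series_space_elem_list[OF k this, of ?ys] obtain U where
    "fps_X ^ r * ?p * (fps_X ^ (k * q) * U) \<in> series_space (Suc m) k" "U $ 0 = 1"
    using xs by (auto simp: sum_list_replicate numeral_2_eq_2)
  then show ?thesis
    using k by (intro exI[of _ "?p * U"]) (simp add: power_add mult_ac fps_X_power_nth)
qed

subsection \<open>Lower bounds for the dimension\<close>

lemma finite_gen_sym_group:
  assumes "k \<ge> 1"
  shows "finite (gen_sym_group n k)"
proof (rule finite_subset)
  let ?R = "insert 0 {z::complex. z ^ k = 1}"
  show "gen_sym_group n k \<subseteq> mat n n ` (({..<n} \<times> {..<n}) \<rightarrow>\<^sub>E ?R)"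
  proof
    fix g assume g: "g \<in> gen_sym_group n k"
    then have "g = mat n n (restrict (($$) g) ({..<n} \<times> {..<n}))"
      by (intro eq_matI) (auto simp: gen_sym_group_def)
    moreover have "restrict (($$) g) ({..<n} \<times> {..<n}) \<in> ({..<n} \<times> {..<n}) \<rightarrow>\<^sub>E ?R"
      using g by (auto simp: gen_sym_group_def)
    ultimately show "g \<in> mat n n ` (({..<n} \<times> {..<n}) \<rightarrow>\<^sub>E ?R)" by blast
  qed
  show "finite (mat n n ` (({..<n} \<times> {..<n}) \<rightarrow>\<^sub>E ?R))"
    using assms by (intro finite_imageI finite_PiE) (auto intro: finite_roots_unity)
qed

lemma sum_fun_apply: "(\<Sum>a\<in>A. f a) g = (\<Sum>a\<in>A. f a g)"
  for f :: "'b \<Rightarrow> 'c \<Rightarrow> 'a::comm_monoid_add"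
  by (induction A rule: infinite_finite_induct) auto

text \<open>\<open>dim\<close> is a \<open>card\<close>, which is 0 for an infinite basis, so finite
  dimension has to be established. The characters vanish off the finite group and hence lie in the
  span of the indicator functions of its elements.\<close>

lemma card_le_dim_span_sym_characters:
  assumes k: "k \<ge> 1" and B: "B \<subseteq> range (sym_character n k)" "fun_space.independent B"
  shows "finite B \<and> card B \<le> dim_span_sym_characters n k"
proof -
  let ?V = "fun_space.span (range (sym_character n k))"
  let ?\<delta> = "\<lambda>h g :: complex mat. if g = h then 1 else 0 :: complex"
  let ?D = "?\<delta> ` gen_sym_group n k"
  have fin: "finite ?D" using finite_gen_sym_group[OF k] by blast
  have "sym_character n k r \<in> fun_space.span ?D" for r
  proof -
    have "sym_character n k r = (\<Sum>h\<in>gen_sym_group n k. fun_scale (sym_character n k r h) (?\<delta> h))"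
    proof
      fix g
      have "(\<Sum>h\<in>gen_sym_group n k. fun_scale (sym_character n k r h) (?\<delta> h)) g
        = (\<Sum>h\<in>gen_sym_group n k. if h = g then sym_character n k r h else 0)"
        unfolding sum_fun_apply by (rule sum.cong) (auto simp: fun_scale_def)
      then show "sym_character n k r g
          = (\<Sum>h\<in>gen_sym_group n k. fun_scale (sym_character n k r h) (?\<delta> h)) g"
        using finite_gen_sym_group[OF k] by (simp add: sym_character_def)
    qed
    also have "\<dots> \<in> fun_space.span ?D"
      by (intro fun_space.span_sum fun_space.span_scale fun_space.span_base) blast
    finally show ?thesis .
  qed
  then have sub: "?V \<subseteq> fun_space.span ?D"
    by (intro fun_space.span_minimal fun_space.subspace_span) blast
  obtain C where C: "C \<subseteq> ?V" "fun_space.independent C" "?V \<subseteq> fun_space.span C"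
    "card C = fun_space.dim ?V"
    by (rule fun_space.basis_exists)
  have "finite C"
    using fun_space.independent_span_bound[OF fin C(2)] C(1) sub by blast
  moreover have "B \<subseteq> fun_space.span C"
    using B(1) C(3) by (meson fun_space.span_superset subset_trans)
  ultimately show ?thesis
    using fun_space.independent_span_bound[OF _ B(2), of C] C(4)
    by (simp add: dim_span_sym_characters_def)
qed

text \<open>The relation is a linear functional on power series; on a generator it is the relation
  evaluated at one group element.\<close>

lemma sym_character_relation_series_space:
  assumes k: "k \<ge> 1" and F: "F \<in> series_space n k"
    and rel: "\<And>g. (\<Sum>r<M. c r * sym_character n k r g) = 0"
  shows "(\<Sum>r<M. c r * F $ r) = 0"
  using F unfolding series_space_def
proof (rule fps_space.span_induct)
  show "fps_space.subspace {F. (\<Sum>r<M. c r * F $ r) = 0}"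
    by (auto simp: fps_space.subspace_def distrib_left sum.distrib mult.left_commute[of "c _"]
        simp flip: sum_distrib_left)
  show "(\<Sum>r<M. c r * F $ r) = 0"
    if F: "F \<in> {monomial_series n \<sigma> w |\<sigma> w. bij_betw \<sigma> {..<n} {..<n} \<and> (\<forall>j<n. w j ^ k = 1)}" for F
  proof -
    obtain \<sigma> w where \<sigma>: "bij_betw \<sigma> {..<n} {..<n}" and w: "\<forall>j<n. w j ^ k = 1"
      and F: "F = monomial_series n \<sigma> w" using F by blast
    have "F $ r = sym_character n k r (monomial_mat n \<sigma> w)" for r
      unfolding F using sym_character_monomial_mat[OF \<sigma> _ k] w by simp
    then show ?thesis using rel by simp
  qed
qed

text \<open>Let \<open>v\<close> be the largest index with \<open>c v \<noteq> 0\<close> and apply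
  the relation to \<open>X^v U\<close>. Its coefficients below \<open>v\<close> are 0 and the one at
  \<open>v\<close> is 1, so only \<open>c v\<close> remains.\<close>

lemma sym_characters_no_relation:
  assumes k: "k \<ge> 1"
    and U: "\<And>v. v < M \<Longrightarrow> \<exists>U. fps_X ^ v * U \<in> series_space n k \<and> U $ 0 = 1"
    and rel: "\<And>g. (\<Sum>r<M. c r * sym_character n k r g) = 0"
    and "r < M"
  shows "c r = 0"
proof (rule ccontr)
  assume "c r \<noteq> 0"
  define v where "v = Max {r. r < M \<and> c r \<noteq> 0}"
  have fin: "finite {r. r < M \<and> c r \<noteq> 0}" by simp
  have ne: "{r. r < M \<and> c r \<noteq> 0} \<noteq> {}" using \<open>c r \<noteq> 0\<close> \<open>r < M\<close> by blast
  have v: "v < M" "c v \<noteq> 0" using Max_in[OF fin ne] by (auto simp: v_def)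
  have above: "c i = 0" if "v < i" "i < M" for i
    using Max_ge[OF fin, of i] that by (force simp: v_def[symmetric])
  obtain U where U: "fps_X ^ v * U \<in> series_space n k" "U $ 0 = 1"
    using U[OF v(1)] by blast
  have "(\<Sum>i<M. c i * (fps_X ^ v * U) $ i) = (\<Sum>i<M. if i = v then c v else 0)"
    by (rule sum.cong) (use above U(2) in \<open>auto simp: fps_X_power_mult_nth\<close>)
  then have "(\<Sum>i<M. c i * (fps_X ^ v * U) $ i) = c v"
    using v(1) by simp
  then show False
    using sym_character_relation_series_space[OF k U(1) rel] v(2) by simp
qed

lemma dim_span_ge:
  assumes k: "k \<ge> 1"
    and U: "\<And>v. v < M \<Longrightarrow> \<exists>U. fps_X ^ v * U \<in> series_space n k \<and> U $ 0 = 1"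
  shows "M \<le> dim_span_sym_characters n k"
proof -
  let ?\<chi> = "sym_character n k"
  \<comment> \<open>Distinctness is needed to count \<open>M\<close> basis elements; two equal
    characters would give a relation with coefficients 1 and -1.\<close>
  have inj: "inj_on ?\<chi> {..<M}"
  proof (rule inj_onI, rule ccontr)
    fix a b assume ab: "a \<in> {..<M}" "b \<in> {..<M}" "?\<chi> a = ?\<chi> b" "a \<noteq> b"
    let ?c = "\<lambda>r. (if r = a then 1 else 0) - (if r = b then 1 else 0 :: complex)"
    have "(\<Sum>r<M. ?c r * ?\<chi> r g) = 0" for g
    proof -
      have "(\<Sum>r<M. ?c r * ?\<chi> r g)
        = (\<Sum>r<M. if r = a then ?\<chi> r g else 0) - (\<Sum>r<M. if r = b then ?\<chi> r g else 0)"
        unfolding sum_subtractf[symmetric] by (rule sum.cong) auto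
      then show ?thesis using ab by simp
    qed
    from sym_characters_no_relation[OF k U this, of a] ab show False by simp
  qed
  have "fun_space.independent (?\<chi> ` {..<M})"
  proof (rule fun_space.independent_if_scalars_zero)
    fix f x
    assume f: "(\<Sum>x\<in>?\<chi> ` {..<M}. fun_scale (f x) x) = 0" and "x \<in> ?\<chi> ` {..<M}"
    then obtain r where r: "r < M" "x = ?\<chi> r" by blast
    have "(\<Sum>r<M. f (?\<chi> r) * ?\<chi> r g) = 0" for g
    proof -
      have "(\<Sum>x\<in>?\<chi> ` {..<M}. fun_scale (f x) x) g = 0" using f by simp
      then show ?thesis
        by (simp add: sum.reindex[OF inj] sum_fun_apply fun_scale_def)
    qed
    from sym_characters_no_relation[OF k U this r(1)] r(2) show "f x = 0" by simp
  qed simp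
  then have "card (?\<chi> ` {..<M}) \<le> dim_span_sym_characters n k"
    using card_le_dim_span_sym_characters[OF k] by blast
  then show ?thesis by (simp add: card_image[OF inj])
qed

text \<open>Every \<open>v < k * N\<close> is \<open>k * q + r\<close> with
  \<open>q = v div k < N\<close> and \<open>r = v mod k < k\<close>, hence a valuation.\<close>

lemma dim_span_ge_binom_sum:
  assumes k: "k \<ge> 1" and N: "\<And>q. q < N \<Longrightarrow> binom_sum m q"
  shows "k * N \<le> dim_span_sym_characters (Suc m) k"
proof (rule dim_span_ge[OF k])
  fix v assume "v < k * N"
  then have "binom_sum m (v div k)"
    by (intro N) (simp add: less_mult_imp_div_less mult.commute)
  from series_space_valuation[OF k _ this, of "v mod k"]
  show "\<exists>U. fps_X ^ v * U \<in> series_space (Suc m) k \<and> U $ 0 = 1"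
    using k by simp
qed

section \<open>The two numerical bounds\<close>

text \<open>All \<open>q\<close> up to \<open>d^2 / 2\<close> are reached, and \<open>k\<close> is
  bounded below by 1. Of the constant 8, one unit pays for replacing \<open>n\<close> by
  \<open>m\<close>, and seven pay for \<open>d^2 \<ge> m^2 - 14 * m * s\<close>.\<close>

lemma dim_span_ge_quadratic:
  assumes k: "k \<ge> 1" and n: "n \<ge> 2"
  shows "real (dim_span_sym_characters n k) \<ge> real n ^ 2 / 2 - 8 * real n powr (3 / 2)"
proof -
  define m where "m = n - 1"
  define s where "s = sqrt (real m)"
  define d where "d = real m - 4 - 3 * s"
  have nm: "n = Suc m" "m \<ge> 1" using n by (auto simp: m_def)
  have s: "s \<ge> 1" "s * s = real m" using nm by (auto simp: s_def)
  have "real n powr (3 / 2) = real n powr 1 * real n powr (1 / 2)"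
    by (subst powr_add[symmetric]) simp
  also have "\<dots> = real n * sqrt (real n)" using n by (simp add: powr_half_sqrt)
  finally have pow: "real n powr (3 / 2) = real n * sqrt (real n)" .
  have "real m * s \<le> real n * sqrt (real n)"
    unfolding s_def nm by (intro mult_mono) auto
  moreover have "real n * 1 \<le> real n * sqrt (real n)"
    by (intro mult_left_mono) (use n in auto)
  moreover have "real n ^ 2 = real m ^ 2 + 2 * real n - 1"
    by (simp add: nm power2_eq_square algebra_simps)
  ultimately have bound: "real n ^ 2 / 2 - 8 * real n powr (3 / 2) \<le> real m ^ 2 / 2 - 7 * (real m * s)"
    unfolding pow by linarith
  have ms: "real m * 1 \<le> real m * s" using s by (intro mult_left_mono) auto
  show ?thesis
  proof (cases "d \<ge> 0")
    case True
    \<comment> \<open>Counting \<open>q = 0\<close> as well gives the successor, which makes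
      \<open>d^2 / 2 \<le> N\<close> survive the rounding.\<close>
    define N where "N = Suc (nat \<lfloor>d\<^sup>2 / 2\<rfloor>)"
    have "binom_sum m q" if "q < N" for q
    proof (rule binom_sum_greedy)
      have "real q \<le> real (nat \<lfloor>d\<^sup>2 / 2\<rfloor>)"
        using that unfolding N_def of_nat_le_iff by (rule less_Suc_eq_le[THEN iffD1])
      also have "\<dots> \<le> d\<^sup>2 / 2" by (rule of_nat_floor) simp
      finally have "sqrt (2 * real q) \<le> sqrt (d\<^sup>2)" by (intro real_sqrt_le_mono) auto
      then show "sqrt (2 * real q) \<le> real m - 4 - 3 * sqrt (real m)"
        using True by (simp add: d_def s_def)
    qed
    then have "k * N \<le> dim_span_sym_characters n k"
      unfolding nm by (rule dim_span_ge_binom_sum[OF k])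
    moreover have "1 * N \<le> k * N" using k by (rule mult_le_mono1)
    ultimately have "real N \<le> real (dim_span_sym_characters n k)" by linarith
    moreover have "d\<^sup>2 / 2 \<le> real N" unfolding N_def by linarith
    moreover have "real m ^ 2 - 14 * (real m * s) \<le> d\<^sup>2"
    proof -
      have "d\<^sup>2 = real m ^ 2 - 8 * real m - 6 * (real m * s) + (4 + 3 * s)\<^sup>2"
        by (simp add: d_def power2_eq_square algebra_simps)
      then show ?thesis using ms zero_le_power2[of "4 + 3 * s"] by linarith
    qed
    ultimately show ?thesis using bound by linarith
  next
    case False
    \<comment> \<open>For negative \<open>d\<close> the claimed bound is itself not
      positive.\<close>
    then have "real m * real m \<le> real m * (4 + 3 * s)"
      by (intro mult_left_mono) (auto simp: d_def)
    then have "real m ^ 2 \<le> 7 * (real m * s)"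
      using ms by (simp add: power2_eq_square algebra_simps)
    then show ?thesis using bound ms by (simp add: mult_nonneg_nonneg)
  qed
qed

text \<open>The value 25/12 is just sharp enough for the logarithmic bound to hold from
  \<open>m = 3\<close> on. Splitting the exponent into 25 steps of 1/12 makes the quadratic Taylor
  bound sufficient.\<close>

lemma ln_8_le: "ln 8 \<le> (25 / 12 :: real)"
proof -
  have "(8::real) \<le> (1 + 1 / 12 + (1 / 12)\<^sup>2 / 2) ^ 25"
    by (simp add: power2_eq_square field_simps)
  also have "\<dots> \<le> exp (1 / 12) ^ 25"
    by (intro power_mono exp_lower_Taylor_quadratic) auto
  also have "\<dots> = exp (25 / 12)"
    by (simp flip: exp_of_nat_mult)
  finally have "ln 8 \<le> ln (exp (25 / 12 :: real))"
    by (subst ln_le_cancel_iff) auto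
  then show ?thesis by simp
qed

lemma dim_span_ge_log:
  assumes k: "k \<ge> 1" and n: "n \<ge> 2"
  shows "real (dim_span_sym_characters n k)
    \<ge> real k * ((real n - 1) * ln (real n - 1) - 2 * (real n - 2))"
proof -
  define m where "m = n - 1"
  have nm: "n = Suc m" "m \<ge> 1" using n by (auto simp: m_def)
  \<comment> \<open>The largest \<open>a\<close> with \<open>2 * a + 1 \<le> m\<close>.\<close>
  define a where "a = (m - 1) div 2"
  define N where "N = Suc a choose 2"
  have "k * N \<le> dim_span_sym_characters n k"
    unfolding nm N_def
    by (rule dim_span_ge_binom_sum[OF k], rule binom_sum_below_triangular, assumption)
      (use nm in \<open>auto simp: a_def\<close>)
  then have kN: "real k * real N \<le> real (dim_span_sym_characters n k)"
    by (metis of_nat_le_iff of_nat_mult)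
  have N: "real N = (real a + 1) * real a / 2"
    by (simp add: N_def choose_two real_of_nat_div algebra_simps)
  have "real m * ln (real m) - 2 * (real m - 1) \<le> real N"
  proof (cases "m \<le> 2")
    case True
    then have "m = 1 \<or> m = 2" using nm by auto
    then show ?thesis using ln_2_less_1 by auto
  next
    case False
    \<comment> \<open>The tangent of \<open>ln\<close> at 8 has slope 1/8, matching the leading term
      \<open>m^2 / 8\<close> of \<open>N\<close>.\<close>
    have "ln (real m) = ln (real m / 8) + ln 8"
      using nm by (simp add: ln_div)
    also have "\<dots> \<le> (real m / 8 - 1) + 25 / 12"
      using nm ln_le_minus_one[of "real m / 8"] ln_8_le by (intro add_mono) auto
    finally have "real m * ln (real m) \<le> real m * (real m / 8 + 13 / 12)"
      by (intro mult_left_mono) auto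
    then have "real m * ln (real m) \<le> real m * real m / 8 + 13 / 12 * real m"
      by (simp add: algebra_simps)
    moreover have "real m * real m / 8 - real m / 4 \<le> real N"
    proof -
      have "real m / 2 - 1 \<le> real a" unfolding a_def by linarith
      then have "(real m / 2) * (real m / 2 - 1) \<le> (real a + 1) * real a"
        using False by (intro mult_mono) auto
      then show ?thesis by (simp add: N algebra_simps)
    qed
    moreover have "real m \<ge> 3" using False by simp
    ultimately show ?thesis by (simp add: field_simps)
  qed
  then have "real k * (real m * ln (real m) - 2 * (real m - 1)) \<le> real k * real N"
    by (rule mult_left_mono) simp
  then show ?thesis using kN by (simp add: nm)
qed

theorem proposition4:
  shows "\<exists>c::real. c > 0 \<and> (\<forall>n k :: nat. n \<ge> 2 \<longrightarrow> k \<ge> 1 \<longrightarrow>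
    real (dim_span_sym_characters n k) \<ge> max (real n ^ 2 / 2 - c * real n powr (3 / 2))
      (real k * ((real n - 1) * ln (real n - 1) - 2 * (real n - 2))))"
  using dim_span_ge_quadratic dim_span_ge_log by (intro exI[of _ 8]) auto

end
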